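(* Let $F$ be a field with a valuation $v$ and value group $\Gamma_v$, let $E/F$ be a finite field extension, and let $w$ be a quasi-valuation on $E$ extending $v$ such that $w(E\setminus\{0\})$ is torsion over $\Gamma_v$. Then $O_w=\{x\in E\mid w(x)\ge0\}$ satisfies the height formula: for every prime ideal $Q$ of $O_w$, $$\text{K-dim}\,O_w=h_{O_w}(Q)+\text{K-dim}(O_w/Q),$$ where $h_{O_w}(Q)$ is the height of $Q$.
   Context: A totally ordered abelian monoid is a commutative monoid $(M,+)$ with a total order such that $a\le b$ implies $a+c\le b+c$. One adjoins $\infty$, greater than all elements of $M$, with $m+\infty=\infty$. A quasi-valuation on a ring $A$ is a function $w:A\to M\cup\{\infty\}$, $M$ a totally ordered abelian monoid, with $w(0)=\infty$, $w(xy)\ge w(x)+w(y)$ and $w(x+y)\ge\min\{w(x),w(y)\}$ for all $x,y\in A$. $w$ extends $v$ means that $\Gamma_v$ is contained in $M$ as an ordered submonoid and $w|_F=v$. For $x\neq 0$ one has $w(x)\neq\infty$. "$w(E\setminus\{0\})$ is torsion over $\Gamma_v$" means: for every $0\ne x\in E$ there is an integer $k\ge1$ with $k\,w(x)\in\Gamma_v$. K-dim is the Krull dimension; heights and dimensions take values in $\mathbb N\cup\{0,\infty\}$. *)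

theory Defs
  imports
    "HOL-Algebra.Algebra"
    "HOL-Library.Extended_Nat"
    "HOL-Library.Lattice_Constructions"
begin

text \<open>
  The type \<open>'m top\<close> from the library adjoins to an ordered type \<open>'m\<close> an element \<open>top.Top\<close>
  above all \<open>top.Value m\<close>. We make \<open>top.Top\<close> absorbing for addition and use it as \<open>\<infinity>\<close>.
  A totally ordered abelian monoid is a type of sort
  \<open>{linorder, ordered_comm_monoid_add}\<close>.
\<close>

instantiation top :: (plus) plus
begin

fun plus_top :: "'a top \<Rightarrow> 'a top \<Rightarrow> 'a top" where
  "plus_top (top.Value a) (top.Value b) = top.Value (a + b)"
| "plus_top top.Top y = top.Top"
| "plus_top x top.Top = top.Top"

instance ..

end

instantiation top :: (zero) zero
begin

definition zero_top :: "'a top" where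
  "zero_top = top.Value 0"

instance ..

end

instance top :: (comm_monoid_add) comm_monoid_add
proof
  fix a b c :: "'a top"
  show "a + b + c = a + (b + c)"
    by (cases a; cases b; cases c) (simp_all add: add.assoc)
  show "a + b = b + a"
    by (cases a; cases b) (simp_all add: add.commute)
  show "0 + a = a"
    by (cases a) (simp_all add: zero_top_def)
qed

instance top :: (ordered_comm_monoid_add) ordered_comm_monoid_add
proof
  fix a b c :: "'a top"
  assume "a \<le> b"
  then show "c + a \<le> c + b"
    by (cases a; cases b; cases c) (simp_all add: add_left_mono)
qed


definition quasi_valuation ::
  "('a, 'r) ring_scheme \<Rightarrow> ('a \<Rightarrow> 'm::{linorder, ordered_comm_monoid_add} top) \<Rightarrow> bool"
  where
  "quasi_valuation A w \<longleftrightarrow>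
     w \<zero>\<^bsub>A\<^esub> = top.Top \<and>
     (\<forall>x\<in>carrier A. \<forall>y\<in>carrier A. w x + w y \<le> w (x \<otimes>\<^bsub>A\<^esub> y)) \<and>
     (\<forall>x\<in>carrier A. \<forall>y\<in>carrier A. min (w x) (w y) \<le> w (x \<oplus>\<^bsub>A\<^esub> y))"

text \<open>
  A (Krull) valuation on a field. It need not be surjective onto \<open>'g\<close>, so the value group is
  the set of its finite values. The trivial valuation is allowed.
\<close>

definition valuation ::
  "('a, 'r) ring_scheme \<Rightarrow> ('a \<Rightarrow> 'g::linordered_ab_group_add top) \<Rightarrow> bool"
  where
  "valuation F v \<longleftrightarrow>
     (\<forall>x\<in>carrier F. v x = top.Top \<longleftrightarrow> x = \<zero>\<^bsub>F\<^esub>) \<and>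
     (\<forall>x\<in>carrier F. \<forall>y\<in>carrier F. v (x \<otimes>\<^bsub>F\<^esub> y) = v x + v y) \<and>
     (\<forall>x\<in>carrier F. \<forall>y\<in>carrier F. min (v x) (v y) \<le> v (x \<oplus>\<^bsub>F\<^esub> y))"

definition value_group ::
  "('a, 'r) ring_scheme \<Rightarrow> ('a \<Rightarrow> 'g top) \<Rightarrow> 'g set"
  where
  "value_group F v = {g. \<exists>x\<in>carrier F - {\<zero>\<^bsub>F\<^esub>}. v x = top.Value g}"

text \<open>
  The inclusion of an ordered submonoid \<open>G\<close> of \<open>'g\<close> into \<open>'m\<close> is an explicit map \<open>\<iota>\<close>, since
  \<open>'g\<close> and \<open>'m\<close> are different types.
\<close>

definition ordered_submonoid_embedding ::
  "'g::{linorder, ordered_comm_monoid_add} set \<Rightarrow>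
   ('g \<Rightarrow> 'm::{linorder, ordered_comm_monoid_add}) \<Rightarrow> bool"
  where
  "ordered_submonoid_embedding G \<iota> \<longleftrightarrow>
     \<iota> 0 = 0 \<and>
     (\<forall>a\<in>G. \<forall>b\<in>G. \<iota> (a + b) = \<iota> a + \<iota> b) \<and>
     (\<forall>a\<in>G. \<forall>b\<in>G. \<iota> a \<le> \<iota> b \<longleftrightarrow> a \<le> b)"

definition extends_valuation ::
  "('a, 'r) ring_scheme \<Rightarrow> ('a \<Rightarrow> 'g::linordered_ab_group_add top) \<Rightarrow>
   ('g \<Rightarrow> 'm::{linorder, ordered_comm_monoid_add}) \<Rightarrow> ('a \<Rightarrow> 'm top) \<Rightarrow> bool"
  where
  "extends_valuation F v \<iota> w \<longleftrightarrow>
     ordered_submonoid_embedding (value_group F v) \<iota> \<and>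
     (\<forall>x\<in>carrier F. w x = map_top \<iota> (v x))"

text \<open>
  A set \<open>S\<close> of values is torsion over \<open>G\<close> if every element of \<open>S\<close> has a positive integer
  multiple in \<open>G\<close>; the \<open>k\<close>-fold multiple of \<open>m\<close> is written as a constant sum.
\<close>

definition torsion_over ::
  "'m::{linorder, ordered_comm_monoid_add} top set \<Rightarrow> 'm set \<Rightarrow> bool"
  where
  "torsion_over S G \<longleftrightarrow> (\<forall>m\<in>S. \<exists>k\<ge>1::nat. (\<Sum>_<k. m) \<in> top.Value ` G)"

definition quasi_valuation_ring ::
  "('a, 'r) ring_scheme \<Rightarrow> ('a \<Rightarrow> 'm::{linorder, ordered_comm_monoid_add} top) \<Rightarrow>
   ('a, 'r) ring_scheme"
  where
  "quasi_valuation_ring E w = E\<lparr>carrier := {x \<in> carrier E. 0 \<le> w x}\<rparr>"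


text \<open>\<open>P 0 \<subset> P 1 \<subset> \<dots> \<subset> P n\<close> is a chain of prime ideals of length \<open>n\<close>.\<close>

definition prime_chain :: "('a, 'r) ring_scheme \<Rightarrow> nat \<Rightarrow> (nat \<Rightarrow> 'a set) \<Rightarrow> bool"
  where
  "prime_chain R n P \<longleftrightarrow> (\<forall>i\<le>n. primeideal (P i) R) \<and> (\<forall>i<n. P i \<subset> P (Suc i))"

definition krull_dim :: "('a, 'r) ring_scheme \<Rightarrow> enat"
  where
  "krull_dim R = Sup {enat n | n. \<exists>P. prime_chain R n P}"

definition height :: "('a, 'r) ring_scheme \<Rightarrow> 'a set \<Rightarrow> enat"
  where
  "height R Q = Sup {enat n | n. \<exists>P. prime_chain R n P \<and> P n = Q}"

end

(* Only three properties of A = O_w matter: E is algebraic over F, V = A \<inter> F is a valuation ring,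
   and the maximal ideal of V is contained in the Jacobson radical of A. The last one is where
   torsion enters. The first two yield incomparability and going down for V \<subseteq> A, the second and
   third yield going up. The primes of V form a chain, so the contractions to V of a chain of primes
   of A can be split at the contraction of Q; going down lifts the lower part to a chain ending
   in Q and going up lifts the upper part to a chain starting in Q. *)

theory Submission
  imports Defs
begin

section \<open>Prime ideals and Krull dimension\<close>

text \<open>\<open>A\<close> need not be integral over \<open>V\<close>: if \<open>v\<close> has
  several extensions to \<open>E\<close>, the valuation ring of one of them is a possible
  \<open>A\<close>. The lifting theorems for integral extensions therefore do not apply, and total
  divisibility in \<open>V\<close> takes their place. It acts in three ways. An algebraic relation
  can be divided by a coefficient of least value. Finitely generated ideals of \<open>V\<close> are
  principal, so each element of the ideal generated by \<open>P \<inter> F\<close> in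
  \<open>A\<close> is a single product. An element of a prime \<open>p\<close> of \<open>V\<close>
  is divisible by every element of \<open>V\<close> outside \<open>p\<close>, with quotient again in
  \<open>p\<close>. Localisation is avoided: a prime with prescribed contraction is found as an
  ideal maximal among those that miss a suitable multiplicative set. Of the two inequalities in the
  height formula, only the bound on the dimension from above requires lifting; the other one is
  concatenation of chains and holds in every commutative ring.\<close>

lemma (in cring) exists_primeideal_avoiding:
  assumes I: "ideal I R"
    and S: "\<one> \<in> S" "\<And>a b. a \<in> S \<Longrightarrow> b \<in> S \<Longrightarrow> a \<otimes> b \<in> S"
    and disj: "I \<inter> S = {}"
  obtains P where "primeideal P R" "I \<subseteq> P" "P \<inter> S = {}"
proof -
  let ?U = "{J. ideal J R \<and> I \<subseteq> J \<and> J \<inter> S = {}}"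
  have "\<exists>M\<in>?U. \<forall>J\<in>?U. M \<subseteq> J \<longrightarrow> J = M"
  proof (rule subset_Zorn_nonempty)
    show "?U \<noteq> {}" using I disj by blast
    fix C assume C: "C \<noteq> {}" "subset.chain ?U C"
    then have "subset.chain {J. ideal J R} C"
      unfolding pred_on.chain_def by auto
    with C(1) have "ideal (\<Union>C) R"
      using chain_Union_is_ideal[of C] by simp
    moreover have "I \<subseteq> \<Union>C" "\<Union>C \<inter> S = {}"
      using C unfolding pred_on.chain_def by blast+
    ultimately show "\<Union>C \<in> ?U" by blast
  qed
  then obtain M where M: "ideal M R" "I \<subseteq> M" "M \<inter> S = {}"
    and max: "\<And>J. ideal J R \<Longrightarrow> M \<subseteq> J \<Longrightarrow> J \<inter> S = {} \<Longrightarrow> J = M"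
    by (smt (verit, best) mem_Collect_eq subset_trans)
  interpret M: ideal M R by (rule M(1))
  \<comment> \<open>By maximality, enlarging \<open>M\<close> by an outside element \<open>a\<close>
    must hit the multiplicative set. If \<open>a\<close> and \<open>b\<close> were both outside with
    \<open>a \<otimes> b\<close> in \<open>M\<close>, the product of the two hits would lie in
    \<open>M\<close> and in \<open>S\<close>.\<close>
  have meets: "\<exists>m x. m \<in> M \<and> x \<in> carrier R \<and> m \<oplus> x \<otimes> a \<in> S"
    if a: "a \<in> carrier R" "a \<notin> M" for a
  proof -
    let ?J = "M <+>\<^bsub>R\<^esub> PIdl a"
    have J: "ideal ?J R"
      using M(1) cgenideal_ideal[OF a(1)] by (rule add_ideals)
    have "m \<in> ?J" if "m \<in> M" for m
      using that M.Icarr[OF that] a(1) unfolding set_add_def' cgenideal_def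
      by (auto intro!: bexI[of _ m] exI[of _ \<zero>])
    moreover have "\<zero> \<oplus> a \<in> ?J"
      using M.zero_closed cgenideal_self[OF a(1)] unfolding set_add_def' by blast
    then have "a \<in> ?J" using a(1) by simp
    ultimately have "?J \<inter> S \<noteq> {}"
      using max[OF J] a(2) by blast
    then show ?thesis
      unfolding set_add_def' cgenideal_def by blast
  qed
  have "primeideal M R"
  proof (rule primeidealI[OF M(1) is_cring])
    show "carrier R \<noteq> M" using S(1) M(3) by blast
    fix a b assume a: "a \<in> carrier R" and b: "b \<in> carrier R" and ab: "a \<otimes> b \<in> M"
    show "a \<in> M \<or> b \<in> M"
    proof (rule ccontr)
      assume "\<not> (a \<in> M \<or> b \<in> M)"
      then obtain m x n y where m: "m \<in> M" "x \<in> carrier R" "m \<oplus> x \<otimes> a \<in> S"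
        and n: "n \<in> M" "y \<in> carrier R" "n \<oplus> y \<otimes> b \<in> S"
        using meets a b by meson
      note carr = a b m(2) n(2) M.Icarr[OF m(1)] M.Icarr[OF n(1)]
      have "(m \<oplus> x \<otimes> a) \<otimes> (n \<oplus> y \<otimes> b)
          = (n \<oplus> y \<otimes> b) \<otimes> m \<oplus> ((x \<otimes> a) \<otimes> n \<oplus> (x \<otimes> y) \<otimes> (a \<otimes> b))"
        using carr by algebra
      also have "\<dots> \<in> M"
        using carr M.I_l_closed[OF m(1)] M.I_l_closed[OF n(1)] M.I_l_closed[OF ab]
        by (intro M.a_closed) simp_all
      finally show False
        using S(2)[OF m(3) n(3)] M(3) by blast
    qed
  qed
  then show thesis using that M by blast
qed

section \<open>Chains of primes, their lengths, and chains in a quotient ring\<close>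

lemma prime_chain_mono:
  assumes "prime_chain R n P" "i \<le> j" "j \<le> n"
  shows "P i \<subseteq> P j"
  using assms(2,3)
proof (induction j rule: dec_induct)
  case (step j)
  then show ?case
    using assms(1) unfolding prime_chain_def by (meson Suc_le_lessD order.strict_implies_order order_trans less_imp_le_nat)
qed auto

lemma prime_chain_Suc_shift:
  "prime_chain R (Suc n) P \<longleftrightarrow>
    primeideal (P 0) R \<and> P 0 \<subset> P 1 \<and> prime_chain R n (\<lambda>i. P (Suc i))"
proof -
  have 1: "(\<forall>i\<le>Suc n. primeideal (P i) R) \<longleftrightarrow>
      primeideal (P 0) R \<and> (\<forall>i\<le>n. primeideal (P (Suc i)) R)"
    using All_less_Suc2[of "Suc n" "\<lambda>i. primeideal (P i) R"] by (simp only: less_Suc_eq_le)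
  have 2: "(\<forall>i<Suc n. P i \<subset> P (Suc i)) \<longleftrightarrow>
      P 0 \<subset> P 1 \<and> (\<forall>i<n. P (Suc i) \<subset> P (Suc (Suc i)))"
    using All_less_Suc2[of n "\<lambda>i. P i \<subset> P (Suc i)"] unfolding One_nat_def .
  show ?thesis
    unfolding prime_chain_def 1 2 by (simp only: conj_ac)
qed

lemma prime_chain_le_krull_dim: "prime_chain R n P \<Longrightarrow> enat n \<le> krull_dim R"
  unfolding krull_dim_def by (rule Sup_upper) blast

lemma prime_chain_le_height: "prime_chain R n P \<Longrightarrow> P n = Q \<Longrightarrow> enat n \<le> height R Q"
  unfolding height_def by (rule Sup_upper) blast

text \<open>If \<open>c\<close> is finite, both sets are bounded, hence finite, and their suprema
  are attained; the bound on elements then applies directly. This avoids arithmetic with infinite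
  suprema.\<close>

lemma enat_Sup_add_Sup_le:
  fixes A B :: "enat set"
  assumes "A \<noteq> {}" "B \<noteq> {}" "\<And>a b. a \<in> A \<Longrightarrow> b \<in> B \<Longrightarrow> a + b \<le> c"
  shows "Sup A + Sup B \<le> c"
proof (cases c)
  case (enat k)
  have fin: "finite D" if "\<forall>x\<in>D. x \<le> c" for D
    using that enat by (intro finite_enat_bounded[of _ k]) auto
  have "\<forall>a\<in>A. a \<le> c" "\<forall>b\<in>B. b \<le> c"
    using assms by (metis add.commute ex_in_conv le_iff_add order_trans)+
  then have "Sup A \<in> A" "Sup B \<in> B"
    using fin assms(1,2) Max_in by (auto simp: Sup_enat_def)
  then show ?thesis using assms(3) by blast
qed simp

context cring
begin

text \<open>The union of the cosets in \<open>J\<close> is the preimage of \<open>J\<close> under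
  the projection, and preimages of primes are prime.\<close>

lemma primeideal_Union_quotient:
  assumes Q: "primeideal Q R" and J: "primeideal J (R Quot Q)"
  shows "primeideal (\<Union>J) R"
proof -
  have QI: "ideal Q R" and JI: "ideal J (R Quot Q)"
    using Q J by (simp_all add: primeideal.axioms)
  then have "J \<subseteq> carrier (R Quot Q)"
    using additive_subgroup.a_subset ideal.axioms(1) by blast
  then have "\<Union>J = {r \<in> carrier R. Q +> r \<in> J}"
    using canonical_proj_vimage_in_carrier[OF QI] canonical_proj_vimage_mem_iff[OF QI] by blast
  then show ?thesis
    using ring_hom_ring.primeideal_vimage[OF ideal.rcos_ring_hom_ring[OF QI] is_cring J] by simp
qed

lemma primeideal_image_quotient:
  assumes Q: "ideal Q R" and P: "primeideal P R" and QP: "Q \<subseteq> P"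
  shows "primeideal ((+>) Q ` P) (R Quot Q)"
proof -
  interpret Q: ideal Q R by fact
  interpret P: primeideal P R by fact
  \<comment> \<open>An ideal containing \<open>Q\<close> is the union of its cosets, so a coset in
    the image has all its representatives in \<open>P\<close>.\<close>
  have mem: "a \<in> P" if "a \<in> carrier R" "Q +> a \<in> (+>) Q ` P" for a
  proof -
    have "a \<in> Q +> a"
      using canonical_proj_vimage_mem_iff[OF Q, of "{Q +> a}" a] that(1)
      by (auto simp: FactRing_def A_RCOSETS_def')
    then have "a \<in> (\<Union>j\<in>P. Q +> j)" using that(2) by auto
    then show ?thesis unfolding iffD1[OF ideal_incl_iff[OF Q P.is_ideal] QP, symmetric] .
  qed
  show ?thesis
  proof (rule primeidealI)
    show "ideal ((+>) Q ` P) (R Quot Q)"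
      using ring_ideal_imp_quot_ideal[OF Q P.is_ideal] .
    show "cring (R Quot Q)"
      by (rule Q.quotient_is_cring[OF is_cring])
    have "Q +> \<one> \<notin> (+>) Q ` P"
      using mem[OF one_closed] P.I_notcarr P.one_imp_carrier by auto
    moreover have "Q +> \<one> \<in> carrier (R Quot Q)"
      by (auto simp: FactRing_def A_RCOSETS_def')
    ultimately show "carrier (R Quot Q) \<noteq> (+>) Q ` P" by blast
    fix U W assume "U \<in> carrier (R Quot Q)" "W \<in> carrier (R Quot Q)"
      and UW: "U \<otimes>\<^bsub>R Quot Q\<^esub> W \<in> (+>) Q ` P"
    then obtain a b where ab: "a \<in> carrier R" "b \<in> carrier R" "U = Q +> a" "W = Q +> b"
      by (auto simp: FactRing_def A_RCOSETS_def')
    then have "Q +> a \<otimes> b \<in> (+>) Q ` P"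
      using UW Q.rcoset_mult_add[OF ab(1,2)] by (simp add: FactRing_def)
    then have "a \<in> P \<or> b \<in> P"
      by (intro P.I_prime mem m_closed ab(1,2))
    then show "U \<in> (+>) Q ` P \<or> W \<in> (+>) Q ` P"
      using ab by blast
  qed
qed

lemma prime_chain_quotient_iff:
  assumes Q: "primeideal Q R"
  shows "(\<exists>P. prime_chain (R Quot Q) n P) \<longleftrightarrow> (\<exists>P. prime_chain R n P \<and> Q \<subseteq> P 0)"
proof
  have QI: "ideal Q R" using Q by (simp add: primeideal.axioms)
  note bij = quot_ideal_correspondence[OF QI]
  {
    assume "\<exists>P. prime_chain (R Quot Q) n P"
    then obtain P where P: "prime_chain (R Quot Q) n P" by blast
    then have PI: "ideal (P i) (R Quot Q)" if "i \<le> n" for i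
      using that by (simp add: prime_chain_def primeideal.axioms)
    have Un: "ideal (\<Union>(P i)) R \<and> Q \<subseteq> \<Union>(P i) \<and> (+>) Q ` \<Union>(P i) = P i" if "i \<le> n" for i
    proof -
      from PI[OF that] obtain J where J: "ideal J R" "Q \<subseteq> J" "(+>) Q ` J = P i"
        using bij unfolding bij_betw_def by (smt (verit) imageE mem_Collect_eq)
      moreover have "\<Union>((+>) Q ` J) = J"
        using ideal_incl_iff[OF QI J(1)] J(2) by simp
      ultimately show ?thesis by simp
    qed
    have "\<Union>(P i) \<subset> \<Union>(P (Suc i))" if "i < n" for i
    proof -
      have "P i \<subset> P (Suc i)" using P that by (simp add: prime_chain_def)
      then show ?thesis
        using Un[of i] Un[of "Suc i"] that
        by (metis Suc_leI Union_mono less_imp_le_nat psubsetE psubsetI subset_refl)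
    qed
    then have "prime_chain R n (\<lambda>i. \<Union>(P i))"
      using P primeideal_Union_quotient[OF Q] by (simp add: prime_chain_def)
    then show "\<exists>P. prime_chain R n P \<and> Q \<subseteq> P 0"
      using Un[of 0] by blast
  }
  {
    assume "\<exists>P. prime_chain R n P \<and> Q \<subseteq> P 0"
    then obtain P where P: "prime_chain R n P" "Q \<subseteq> P 0" by blast
    then have QP: "Q \<subseteq> P i" if "i \<le> n" for i
      using prime_chain_mono[OF P(1), of 0 i] that by simp
    have "(+>) Q ` P i \<subset> (+>) Q ` P (Suc i)" if "i < n" for i
    proof -
      have sub: "P i \<subset> P (Suc i)" using P that by (simp add: prime_chain_def)
      have "(+>) Q ` P i \<noteq> (+>) Q ` P (Suc i)"
      proof
        assume "(+>) Q ` P i = (+>) Q ` P (Suc i)"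
        moreover have "ideal (P i) R" "ideal (P (Suc i)) R"
          using P(1) that by (simp_all add: prime_chain_def primeideal.axioms)
        ultimately have "P i = P (Suc i)"
          using bij QP[of i] QP[of "Suc i"] that
          unfolding bij_betw_def inj_on_def by auto
        with sub show False by blast
      qed
      then show ?thesis using sub by blast
    qed
    then have "prime_chain (R Quot Q) n (\<lambda>i. (+>) Q ` P i)"
      using P(1) primeideal_image_quotient[OF QI _ QP] by (simp add: prime_chain_def)
    then show "\<exists>P. prime_chain (R Quot Q) n P" by blast
  }
qed

lemma krull_dim_quotient:
  assumes "primeideal Q R"
  shows "krull_dim (R Quot Q) = Sup {enat n | n. \<exists>P. prime_chain R n P \<and> Q \<subseteq> P 0}"
  unfolding krull_dim_def by (simp add: prime_chain_quotient_iff[OF assms])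

lemma height_add_krull_dim_quotient_le:
  assumes Q: "primeideal Q R"
  shows "height R Q + krull_dim (R Quot Q) \<le> krull_dim R"
  unfolding height_def krull_dim_quotient[OF Q]
proof (rule enat_Sup_add_Sup_le)
  have "prime_chain R 0 (\<lambda>_. Q)" using Q by (simp add: prime_chain_def)
  then show "{enat n |n. \<exists>P. prime_chain R n P \<and> P n = Q} \<noteq> {}"
    "{enat n |n. \<exists>P. prime_chain R n P \<and> Q \<subseteq> P 0} \<noteq> {}" by blast+
  fix a b assume "a \<in> {enat n |n. \<exists>P. prime_chain R n P \<and> P n = Q}"
    and "b \<in> {enat n |n. \<exists>P. prime_chain R n P \<and> Q \<subseteq> P 0}"
  then obtain m n P P' where a: "a = enat m" "prime_chain R m P" "P m = Q"
    and b: "b = enat n" "prime_chain R n P'" "Q \<subseteq> P' 0" by blast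
  \<comment> \<open>At index \<open>m\<close> stands \<open>Q\<close>, which replaces
    \<open>P' 0\<close>: the inclusion \<open>Q \<subseteq> P' 0\<close> may be an equality.
    Strictness at the junction comes from \<open>P' 0 \<subset> P' 1\<close>, and the length is
    still \<open>m + n\<close>.\<close>
  let ?C = "\<lambda>i. if i \<le> m then P i else P' (i - m)"
  have "?C i \<subset> ?C (Suc i)" if "i < m + n" for i
  proof -
    consider "i < m" | "i = m" "0 < n" | "m < i" using \<open>i < m + n\<close> by linarith
    then show ?thesis
    proof cases
      case 2
      then have "P' 0 \<subset> P' 1" using b(2) by (simp add: prime_chain_def)
      then show ?thesis using 2 a(3) b(3) by auto
    next
      case 3
      then have "P' (i - m) \<subset> P' (Suc (i - m))"
        using b(2) that by (simp add: prime_chain_def)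
      then show ?thesis using 3 by (simp add: Suc_diff_le)
    qed (use a(2) in \<open>simp add: prime_chain_def\<close>)
  qed
  moreover have "primeideal (?C i) R" if "i \<le> m + n" for i
    using a(2) b(2) that by (simp add: prime_chain_def)
  ultimately have "prime_chain R (m + n) ?C" unfolding prime_chain_def by blast
  then show "a + b \<le> krull_dim R"
    using a(1) b(1) prime_chain_le_krull_dim by fastforce
qed

end

section \<open>Subrings lying over a valuation ring\<close>

text \<open>\<open>V = A \<inter> F\<close> is never formed as a ring of its own; units are
  recognised by inverses taken in \<open>E\<close>. An element \<open>a\<close> of \<open>V\<close>
  is a nonunit when \<open>inv a\<close> lies outside \<open>A\<close>, and \<open>jacobson\<close>
  is the criterion that \<open>1 - a r\<close> is a unit of \<open>A\<close> for all
  \<open>r\<close>. The clause \<open>a \<otimes> r \<noteq> \<one>\<close> is stated separately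
  because \<open>inv \<zero>\<close> is unspecified.\<close>

locale algebraic_valuation_ext = field E for E (structure) +
  fixes F A :: "'a set"
  assumes F: "subfield F E"
    and A: "subring A E"
    and algebraic: "x \<in> carrier E \<Longrightarrow> (algebraic over F) x"
    and valuation_ring: "x \<in> F \<Longrightarrow> x \<notin> A \<Longrightarrow> inv x \<in> A"
    and jacobson: "a \<in> F \<Longrightarrow> a \<in> A \<Longrightarrow> a \<noteq> \<zero> \<Longrightarrow> inv a \<notin> A \<Longrightarrow> r \<in> A \<Longrightarrow>
      a \<otimes> r \<noteq> \<one> \<and> inv (\<one> \<ominus> a \<otimes> r) \<in> A"
begin

abbreviation "S \<equiv> E\<lparr>carrier := A\<rparr>"

lemma cring_S: "cring S"
  using subcring_iff[OF subringE(1)[OF A]] subcringI'[OF A] by simp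

lemma A_carrier: "x \<in> A \<Longrightarrow> x \<in> carrier E"
  using subringE(1)[OF A] by blast

lemma F_carrier: "x \<in> F \<Longrightarrow> x \<in> carrier E"
  using subfieldE(3)[OF F] by blast

lemma F_inv: "x \<in> F \<Longrightarrow> x \<noteq> \<zero> \<Longrightarrow> inv x \<in> F"
  using subfield_m_inv(1)[OF F] by blast

lemma inv_nz:
  assumes "x \<in> carrier E" "x \<noteq> \<zero>"
  shows "inv x \<in> carrier E" "x \<otimes> inv x = \<one>" "inv x \<otimes> x = \<one>" "inv x \<noteq> \<zero>"
proof -
  show inv: "inv x \<in> carrier E" "x \<otimes> inv x = \<one>" "inv x \<otimes> x = \<one>"
    using assms by (simp_all add: field_Units)
  then show "inv x \<noteq> \<zero>" using assms(1) by (metis r_null zero_not_one)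
qed

lemma ideal_S:
  assumes "ideal P S"
  shows "P \<subseteq> A" "\<zero> \<in> P" "x \<in> P \<Longrightarrow> y \<in> P \<Longrightarrow> x \<oplus> y \<in> P"
    "x \<in> P \<Longrightarrow> a \<in> A \<Longrightarrow> x \<otimes> a \<in> P" "x \<in> P \<Longrightarrow> a \<in> A \<Longrightarrow> a \<otimes> x \<in> P"
    "x \<in> P \<Longrightarrow> \<ominus> x \<in> P"
proof -
  interpret P: ideal P S by fact
  show PA: "P \<subseteq> A"
    using P.a_subset by simp
  show "\<zero> \<in> P"
    using additive_subgroup.zero_closed[OF P.is_additive_subgroup] by simp
  show "x \<in> P \<Longrightarrow> y \<in> P \<Longrightarrow> x \<oplus> y \<in> P"
    using additive_subgroup.a_closed[OF P.is_additive_subgroup, of x y] by simp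
  show "x \<in> P \<Longrightarrow> a \<in> A \<Longrightarrow> x \<otimes> a \<in> P"
    using P.I_r_closed[of x a] by simp
  show l: "x \<in> P \<Longrightarrow> a \<in> A \<Longrightarrow> a \<otimes> x \<in> P" for a
    using P.I_l_closed[of x a] by simp
  show "\<ominus> x \<in> P" if "x \<in> P"
  proof -
    have "\<ominus> \<one> \<otimes> x = \<ominus> x"
      using that PA A_carrier[of x] by (simp add: l_minus subset_iff)
    then show ?thesis
      using l[OF that subringE(5)[OF A subringE(3)[OF A]]] by simp
  qed
qed

lemma primeideal_S:
  assumes "primeideal P S"
  shows "ideal P S" "\<one> \<notin> P" "x \<in> A \<Longrightarrow> y \<in> A \<Longrightarrow> x \<otimes> y \<in> P \<Longrightarrow> x \<in> P \<or> y \<in> P"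
proof -
  interpret P: primeideal P S by fact
  show "ideal P S" by (rule P.is_ideal)
  show "\<one> \<notin> P" using P.I_notcarr P.one_imp_carrier by auto
  show "x \<in> A \<Longrightarrow> y \<in> A \<Longrightarrow> x \<otimes> y \<in> P \<Longrightarrow> x \<in> P \<or> y \<in> P"
    using P.I_prime[of x y] by simp
qed

section \<open>Divisibility in the valuation ring, primitive relations and incomparability\<close>

lemma F_dvd_total:
  assumes "a \<in> F" "b \<in> F" "a \<noteq> \<zero>"
  shows "inv a \<otimes> b \<in> A \<or> (b \<noteq> \<zero> \<and> inv b \<otimes> a \<in> A)"
proof -
  note a = inv_nz[OF F_carrier[OF assms(1)] assms(3)]
  have "inv a \<otimes> b \<in> F"
    using F_inv[OF assms(1,3)] assms(2) subringE(6)[OF subfieldE(1)[OF F]] by blast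
  moreover have "inv (inv a \<otimes> b) = inv b \<otimes> a" if "b \<noteq> \<zero>"
  proof (rule inv_unique'[symmetric])
    note b = inv_nz[OF F_carrier[OF assms(2)] that]
    note c = a(1) b(1) F_carrier[OF assms(1)] F_carrier[OF assms(2)]
    have "inv a \<otimes> b \<otimes> (inv b \<otimes> a) = (inv a \<otimes> a) \<otimes> (b \<otimes> inv b)"
      using c by algebra
    then show "inv a \<otimes> b \<otimes> (inv b \<otimes> a) = \<one>" using a b by simp
    then show "inv b \<otimes> a \<otimes> (inv a \<otimes> b) = \<one>" using c m_comm[of "inv b \<otimes> a"] by simp
  qed (use inv_nz[OF F_carrier[OF assms(2)] that] a F_carrier assms in auto)
  moreover have "inv a \<otimes> b \<in> A" if "b = \<zero>"
    using that a subringE(2)[OF A] by simp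
  ultimately show ?thesis using valuation_ring by metis
qed

text \<open>In terms of a valuation, \<open>a\<close> is an entry of least value. Going through the
  list, the current candidate is kept or replaced by the new entry, whichever divides the
  other.\<close>

lemma exists_common_divisor:
  assumes "set p \<subseteq> F" "\<exists>b\<in>set p. b \<noteq> \<zero>"
  obtains a where "a \<in> set p" "a \<noteq> \<zero>" "\<And>b. b \<in> set p \<Longrightarrow> inv a \<otimes> b \<in> A"
proof -
  have "\<exists>a\<in>set p. a \<noteq> \<zero> \<and> (\<forall>b\<in>set p. inv a \<otimes> b \<in> A)"
    using assms
  proof (induction p)
    case (Cons c p)
    then have c: "c \<in> F" by simp
    have self: "inv c \<otimes> c \<in> A" if "c \<noteq> \<zero>"
      using inv_nz[OF F_carrier[OF c] that] subringE(3)[OF A] by simp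
    show ?case
    proof (cases "\<exists>b\<in>set p. b \<noteq> \<zero>")
      case False
      have "inv c \<otimes> \<zero> \<in> A" if "c \<noteq> \<zero>"
        using inv_nz[OF F_carrier[OF c] that] subringE(2)[OF A] by simp
      then show ?thesis
        using False Cons.prems self by (metis set_ConsD list.set_intros(1))
    next
      case True
      then obtain a where a: "a \<in> set p" "a \<noteq> \<zero>" "\<And>b. b \<in> set p \<Longrightarrow> inv a \<otimes> b \<in> A"
        using Cons by auto
      have aF: "a \<in> F" using a Cons.prems by auto
      consider "inv a \<otimes> c \<in> A" | "c \<noteq> \<zero>" "inv c \<otimes> a \<in> A"
        using F_dvd_total[OF aF c a(2)] by blast
      then show ?thesis
      proof cases
        case 1
        then show ?thesis using a by auto
      next
        case 2
        have "inv c \<otimes> b \<in> A" if "b \<in> set p" for b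
        proof -
          have bF: "b \<in> carrier E" using that Cons.prems F_carrier by auto
          note i = inv_nz[OF F_carrier[OF aF] a(2)] inv_nz[OF F_carrier[OF c] 2(1)]
          have "(inv c \<otimes> a) \<otimes> (inv a \<otimes> b) = inv c \<otimes> (a \<otimes> inv a) \<otimes> b"
            using i(1,5) F_carrier[OF aF] bF by algebra
          then show ?thesis
            using subringE(6)[OF A 2(2) a(3)[OF that]] i bF by simp
        qed
        then show ?thesis using 2 self by auto
      qed
    qed
  qed simp
  then show thesis using that by blast
qed

lemma eval_scale:
  assumes "set p \<subseteq> carrier E" "c \<in> carrier E" "x \<in> carrier E"
  shows "eval (map ((\<otimes>) c) p) x = c \<otimes> eval p x"
  using assms(1)
proof (induction p)
  case (Cons a p)
  then show ?case
    using assms(2,3) eval_in_carrier[of p x] by (simp add: r_distr m_assoc)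
qed (use assms in simp)

text \<open>An algebraic relation is divided by a coefficient of least value. The coefficient that
  becomes 1 need not be the leading one, so this is weaker than integrality of \<open>x\<close> over
  \<open>V\<close>, yet it suffices for incomparability.\<close>

lemma exists_primitive_relation:
  assumes "x \<in> carrier E"
  obtains p where "set p \<subseteq> A \<inter> F" "\<one> \<in> set p" "eval p x = \<zero>"
proof -
  obtain q where q: "q \<in> carrier (F[X])" "q \<noteq> []" "eval q x = \<zero>"
    using algebraicE[OF subfieldE(1)[OF F] assms algebraic[OF assms]] by blast
  then have qF: "set q \<subseteq> F" and "hd q \<noteq> \<zero>"
    by (auto simp: univ_poly_def polynomial_def)
  then obtain a where a: "a \<in> set q" "a \<noteq> \<zero>" "\<And>b. b \<in> set q \<Longrightarrow> inv a \<otimes> b \<in> A"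
    using exists_common_divisor[of q] q(2) by (metis hd_in_set)
  then have aF: "a \<in> F" using qF by blast
  note i = inv_nz[OF F_carrier[OF aF] a(2)]
  have "eval (map ((\<otimes>) (inv a)) q) x = \<zero>"
    using eval_scale[of q "inv a" x] qF F_carrier i(1) assms q(3) by auto
  moreover have "set (map ((\<otimes>) (inv a)) q) \<subseteq> A \<inter> F"
    using a(3) qF F_inv[OF aF a(2)] subringE(6)[OF subfieldE(1)[OF F]] by auto
  moreover have "\<one> \<in> set (map ((\<otimes>) (inv a)) q)"
    using a(1) i(3) by force
  ultimately show thesis using that by blast
qed

text \<open>Suppose the contractions agree and take \<open>x\<close> in \<open>Q\<close> but not in
  \<open>P\<close>. In a polynomial over \<open>V\<close> whose value at \<open>x\<close> lies in
  \<open>P\<close>, the constant term lies in \<open>Q\<close>, hence in \<open>P\<close>;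
  subtracting it and cancelling \<open>x\<close>, which is outside the prime \<open>P\<close>,
  lowers the degree. So all coefficients lie in \<open>P\<close>, which contradicts a primitive
  relation.\<close>

lemma incomparability:
  assumes P: "primeideal P S" and Q: "primeideal Q S" and PQ: "P \<subset> Q"
  shows "P \<inter> F \<subset> Q \<inter> F"
proof (rule ccontr)
  assume "\<not> P \<inter> F \<subset> Q \<inter> F"
  then have eq: "Q \<inter> F \<subseteq> P" using PQ by blast
  note P' = primeideal_S[OF P] and Q' = primeideal_S[OF Q]
  note PI = ideal_S[OF P'(1)] and QI = ideal_S[OF Q'(1)]
  obtain x where x: "x \<in> Q" "x \<notin> P" using PQ by blast
  then have xA: "x \<in> A" using QI by blast
  have coeffs: "set p \<subseteq> P" if "set p \<subseteq> A \<inter> F" "eval p x \<in> P" for p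
    using that
  proof (induction p rule: rev_induct)
    case (snoc a p)
    have pA: "set p \<subseteq> A" using snoc.prems by auto
    have ev: "eval p x \<in> A"
      using pA
    proof (induction p)
      case (Cons b p)
      have "x [^] k \<in> A" for k :: nat
        by (induction k) (use xA subringE(3,6)[OF A] in auto)
      then show ?case using Cons subringE(6,7)[OF A] by simp
    qed (use subringE(2)[OF A] in simp)
    have a: "a \<in> A" "a \<in> F" using snoc.prems by auto
    have carr: "eval p x \<in> carrier E" "a \<in> carrier E" "x \<in> carrier E"
      using ev a xA A_carrier by blast+
    \<comment> \<open>Coefficient lists end with the constant term, so \<open>a\<close> is the
      constant term and \<open>eval p x\<close> is what remains after division by
      \<open>x\<close>.\<close>
    have split: "eval p x \<otimes> x \<oplus> a \<in> P"
      using snoc.prems(2) eval_append_aux[of p a x] pA subringE(1)[OF A] carr by auto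
    have "a = (eval p x \<otimes> x \<oplus> a) \<oplus> \<ominus> (eval p x \<otimes> x)"
      using carr by algebra
    also have "\<dots> \<in> Q"
      using split PQ QI(3,5,6) x(1) ev by blast
    finally have aP: "a \<in> P" using eq a by blast
    have "eval p x \<otimes> x = (eval p x \<otimes> x \<oplus> a) \<oplus> \<ominus> a"
      using carr by algebra
    also have "\<dots> \<in> P"
      using split aP PI(3,6) by blast
    finally have "eval p x \<in> P"
      using P'(3)[OF ev xA] x(2) by blast
    then show ?case using snoc aP by auto
  qed simp
  obtain p where p: "set p \<subseteq> A \<inter> F" "\<one> \<in> set p" "eval p x = \<zero>"
    using exists_primitive_relation[OF A_carrier[OF xA]] .
  then have "set p \<subseteq> P" using coeffs[OF p(1)] PI(2) by simp
  then show False using p(2) P'(2) by blast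
qed

section \<open>Lifting a single prime with prescribed contraction\<close>

lemma contractions_comparable:
  assumes "ideal P S" "ideal Q S"
  shows "P \<inter> F \<subseteq> Q \<inter> F \<or> Q \<inter> F \<subseteq> P \<inter> F"
proof (rule ccontr)
  note PI = ideal_S[OF assms(1)] and QI = ideal_S[OF assms(2)]
  assume "\<not> ?thesis"
  then obtain a b where a: "a \<in> P" "a \<in> F" "a \<notin> Q" and b: "b \<in> Q" "b \<in> F" "b \<notin> P" by blast
  have nz: "a \<noteq> \<zero>" "b \<noteq> \<zero>" using a b PI(2) QI(2) by auto
  have "c \<otimes> (inv c \<otimes> d) = d" if "c \<in> F" "c \<noteq> \<zero>" "d \<in> F" for c d
    using inv_nz[OF F_carrier] that F_carrier by (simp add: m_assoc[symmetric])
  then show False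
    using F_dvd_total[OF a(2) b(2) nz(1)] PI(4)[OF a(1)] QI(4)[OF b(1)] a b nz by metis
qed

text \<open>This is \<open>Q\<close> plus the ideal of \<open>A\<close> generated by
  \<open>P \<inter> F\<close>. Single products replace finite sums: of two coefficients in
  \<open>F\<close> one divides the other over \<open>A\<close>, so \<open>a r + b s\<close>
  collapses to one product (\<open>comb\<close>). Going up takes the given \<open>Q\<close>, going
  down takes the zero ideal.\<close>

lemma ideal_extended_contraction:
  assumes Q: "ideal Q S" and P: "ideal P S"
  shows "ideal {z \<oplus> a \<otimes> r | z a r. z \<in> Q \<and> a \<in> P \<inter> F \<and> r \<in> A} S" (is "ideal ?I S")
proof -
  interpret S: cring S by (rule cring_S)
  note QI = ideal_S[OF Q] and PI = ideal_S[OF P]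
  have comb: "\<exists>c\<in>P \<inter> F. \<exists>t\<in>A. a \<otimes> r \<oplus> b \<otimes> s = c \<otimes> t"
    if ab: "a \<in> P" "a \<in> F" "b \<in> P" "b \<in> F" and rs: "r \<in> A" "s \<in> A" for a b r s
  proof -
    have key: "\<exists>t\<in>A. a \<otimes> r \<oplus> b \<otimes> s = a \<otimes> t"
      if "a \<in> F" "b \<in> F" "a \<noteq> \<zero>" "inv a \<otimes> b \<in> A" "r \<in> A" "s \<in> A" for a b r s
    proof
      note i = inv_nz[OF F_carrier[OF that(1)] that(3)]
      note c = i F_carrier[OF that(1)] F_carrier[OF that(2)] A_carrier[OF that(5)] A_carrier[OF that(6)]
      have "a \<otimes> (r \<oplus> inv a \<otimes> b \<otimes> s) = a \<otimes> r \<oplus> (a \<otimes> inv a) \<otimes> (b \<otimes> s)"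
        using c(1,5,6,7,8) by algebra
      then show "a \<otimes> r \<oplus> b \<otimes> s = a \<otimes> (r \<oplus> inv a \<otimes> b \<otimes> s)"
        using c by simp
      show "r \<oplus> inv a \<otimes> b \<otimes> s \<in> A"
        using that subringE(6,7)[OF A] by blast
    qed
    show ?thesis
    proof (cases "a = \<zero>")
      case True
      then have "a \<otimes> r \<oplus> b \<otimes> s = b \<otimes> s" using ab rs A_carrier F_carrier by simp
      then show ?thesis using ab rs by blast
    next
      case False
      then consider "inv a \<otimes> b \<in> A" | "b \<noteq> \<zero>" "inv b \<otimes> a \<in> A"
        using F_dvd_total[OF ab(2,4)] by blast
      then show ?thesis
      proof cases
        case 1
        then show ?thesis using key[OF ab(2,4) False 1 rs] ab by blast
      next
        case 2
        have "a \<otimes> r \<oplus> b \<otimes> s = b \<otimes> s \<oplus> a \<otimes> r"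
          using ab rs A_carrier F_carrier by (simp add: a_comm)
        then show ?thesis using key[OF ab(4,2) 2(1,2) rs(2,1)] ab by (metis IntI)
      qed
    qed
  qed
  have carr: "z \<in> carrier E" "a \<in> carrier E" "r \<in> carrier E"
    if "z \<in> Q" "a \<in> F" "r \<in> A" for z a r
    using that QI(1) F_carrier A_carrier by blast+
  define I where "I = ?I"
  have memE: "\<exists>z a r. x = z \<oplus> a \<otimes> r \<and> z \<in> Q \<and> a \<in> P \<and> a \<in> F \<and> r \<in> A" if "x \<in> I" for x
    using that unfolding I_def by blast
  have memI: "z \<oplus> a \<otimes> r \<in> I" if "z \<in> Q" "a \<in> P" "a \<in> F" "r \<in> A" for z a r
    using that unfolding I_def by blast
  have IA: "x \<in> A" if x: "x \<in> I" for x
  proof -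
    obtain z a r where "x = z \<oplus> a \<otimes> r" "z \<in> Q" "a \<in> P" "r \<in> A"
      using memE[OF x] by blast
    then show ?thesis
      using subringE(7)[OF A, of z "a \<otimes> r"] subringE(6)[OF A, of a r] QI(1) PI(1) by auto
  qed
  have add: "x \<oplus> y \<in> I" if xy: "x \<in> I" "y \<in> I" for x y
  proof -
    obtain z a r where x: "x = z \<oplus> a \<otimes> r" "z \<in> Q" "a \<in> P" "a \<in> F" "r \<in> A"
      using memE[OF xy(1)] by blast
    obtain z' b s where y: "y = z' \<oplus> b \<otimes> s" "z' \<in> Q" "b \<in> P" "b \<in> F" "s \<in> A"
      using memE[OF xy(2)] by blast
    obtain c t where ct: "c \<in> P" "c \<in> F" "t \<in> A" "a \<otimes> r \<oplus> b \<otimes> s = c \<otimes> t"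
      using comb[OF x(3,4) y(3,4) x(5) y(5)] by blast
    have "x \<oplus> y = (z \<oplus> z') \<oplus> (a \<otimes> r \<oplus> b \<otimes> s)"
      unfolding x(1) y(1) using carr[OF x(2,4,5)] carr[OF y(2,4,5)] by algebra
    then show ?thesis
      using memI[OF QI(3)[OF x(2) y(2)] ct(1-3)] ct(4) by simp
  qed
  have smult: "x \<otimes> y \<in> I" if xy: "x \<in> I" "y \<in> A" for x y
  proof -
    obtain z a r where x: "x = z \<oplus> a \<otimes> r" "z \<in> Q" "a \<in> P" "a \<in> F" "r \<in> A"
      using memE[OF xy(1)] by blast
    have "x \<otimes> y = z \<otimes> y \<oplus> a \<otimes> (r \<otimes> y)"
      unfolding x(1) using carr[OF x(2,4,5)] A_carrier[OF xy(2)] by algebra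
    then show ?thesis
      using memI[OF QI(4)[OF x(2) xy(2)] x(3,4) subringE(6)[OF A x(5) xy(2)]] by simp
  qed
  have "ideal I S"
  proof (rule idealI)
    show "ring S" by (rule S.ring_axioms)
    have "\<zero> \<in> I"
      using memI[OF QI(2) PI(2) subringE(2)[OF subfieldE(1)[OF F]] subringE(2)[OF A]] by simp
    moreover have "\<ominus>\<^bsub>S\<^esub> x \<in> I" if x: "x \<in> I" for x
    proof -
      have "x \<in> carrier S" using IA[OF x] by simp
      then have "\<ominus>\<^bsub>S\<^esub> x = x \<otimes>\<^bsub>S\<^esub> \<ominus>\<^bsub>S\<^esub> \<one>\<^bsub>S\<^esub>"
        by (simp only: S.r_minus S.one_closed S.r_one)
      moreover have "\<ominus>\<^bsub>S\<^esub> \<one>\<^bsub>S\<^esub> \<in> A"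
        using S.a_inv_closed[OF S.one_closed] by simp
      ultimately show ?thesis using smult[OF x] by simp
    qed
    ultimately show "subgroup I (add_monoid S)"
      using IA add by (intro S.add.subgroupI) (auto simp: a_inv_def[symmetric])
    fix x y assume xy: "x \<in> I" "y \<in> carrier S"
    then show *: "x \<otimes>\<^bsub>S\<^esub> y \<in> I" using smult by simp
    have "x \<in> carrier S" using IA[OF xy(1)] by simp
    then show "y \<otimes>\<^bsub>S\<^esub> x \<in> I" using * S.m_comm[OF _ xy(2)] by metis
  qed
  then show ?thesis unfolding I_def .
qed

text \<open>If \<open>s\<close> did not divide \<open>a\<close>, then \<open>a\<close> would divide
  \<open>s\<close> and force \<open>s\<close> into \<open>P\<close>. The quotient \<open>b\<close>
  lies in \<open>P\<close> because \<open>s \<otimes> b\<close> does and \<open>s\<close> does not.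
  Being in a proper ideal, \<open>b\<close> is a nonunit, which is what \<open>jacobson\<close> asks
  for.\<close>

lemma divide_contraction:
  assumes P: "primeideal P S" and a: "a \<in> P" "a \<in> F" "a \<noteq> \<zero>" and s: "s \<in> A" "s \<in> F" "s \<notin> P"
  obtains b where "b \<in> P" "b \<in> F" "b \<noteq> \<zero>" "inv b \<notin> A" "a = s \<otimes> b" "s \<noteq> \<zero>"
proof -
  note P' = primeideal_S[OF P]
  note PI = ideal_S[OF P'(1)]
  let ?b = "inv s \<otimes> a"
  have nz: "s \<noteq> \<zero>" using s(3) PI(2) by blast
  note i = inv_nz[OF F_carrier[OF s(2)] nz] inv_nz[OF F_carrier[OF a(2)] a(3)]
  note c = F_carrier[OF s(2)] F_carrier[OF a(2)]
  have eq: "a = s \<otimes> ?b" using i c by (simp add: m_assoc[symmetric])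
  have bF: "?b \<in> F"
    using F_inv[OF s(2) nz] a(2) subringE(6)[OF subfieldE(1)[OF F]] by blast
  have "s = a \<otimes> (inv a \<otimes> s)" using i c by (simp add: m_assoc[symmetric])
  then have "inv a \<otimes> s \<notin> A" using PI(4)[OF a(1)] s(3) by metis
  then have "?b \<in> A" using F_dvd_total[OF s(2) a(2) nz] by blast
  then have bP: "?b \<in> P" using P'(3)[OF s(1)] eq a(1) s(3) by metis
  have bnz: "?b \<noteq> \<zero>" using eq a(3) c by auto
  have "inv ?b \<notin> A"
    using PI(4)[OF bP] inv_nz[OF F_carrier[OF bF] bnz] P'(2) by metis
  then show thesis using that[OF bP bF bnz _ eq nz] by blast
qed

text \<open>The prime is to contain \<open>Q\<close> and \<open>P \<inter> F\<close> and to miss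
  \<open>V - P\<close>. The obstruction would be an element \<open>s = z + a r\<close> of
  \<open>V - P\<close> with \<open>z\<close> in \<open>Q\<close>. Writing \<open>a = s b\<close>
  gives \<open>z = s (1 - b r)\<close>, and \<open>1 - b r\<close> is a unit of \<open>A\<close> by
  \<open>jacobson\<close>, so \<open>s\<close> lies in \<open>Q \<inter> F\<close> and hence in
  \<open>P\<close>.\<close>

lemma going_up:
  assumes Q: "primeideal Q S" and P: "primeideal P S" and QP: "Q \<inter> F \<subseteq> P \<inter> F"
  obtains Q' where "primeideal Q' S" "Q \<subseteq> Q'" "Q' \<inter> F = P \<inter> F"
proof -
  interpret S: cring S by (rule cring_S)
  note P' = primeideal_S[OF P] and Q' = primeideal_S[OF Q]
  note PI = ideal_S[OF P'(1)] and QI = ideal_S[OF Q'(1)]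
  let ?I = "{z \<oplus> a \<otimes> r | z a r. z \<in> Q \<and> a \<in> P \<inter> F \<and> r \<in> A}"
  let ?T = "A \<inter> F - P"
  have "z \<oplus> a \<otimes> r \<notin> ?T" if z: "z \<in> Q" and a: "a \<in> P" "a \<in> F" and r: "r \<in> A" for z a r
  proof
    define s where "s = z \<oplus> a \<otimes> r"
    assume "z \<oplus> a \<otimes> r \<in> ?T"
    then have s: "s \<in> A" "s \<in> F" "s \<notin> P" by (simp_all add: s_def)
    then have sQ: "s \<notin> Q" using QP by blast
    have zc: "z \<in> carrier E" using z QI(1) A_carrier by blast
    then have "a \<noteq> \<zero>" using sQ z r A_carrier by (auto simp: s_def)
    then obtain b where b: "b \<in> P" "b \<in> F" "b \<noteq> \<zero>" "inv b \<notin> A" "a = s \<otimes> b"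
      using divide_contraction[OF P a _ s] by blast
    note c = zc A_carrier[OF s(1)] A_carrier[OF r] F_carrier[OF b(2)]
    have u: "b \<otimes> r \<noteq> \<one>" "inv (\<one> \<ominus> b \<otimes> r) \<in> A"
      using jacobson[OF b(2) _ b(3,4) r] b(1) PI(1) by auto
    let ?u = "\<one> \<ominus> b \<otimes> r"
    have "?u \<noteq> \<zero>" using u(1) c by (metis m_closed one_closed r_right_minus_eq)
    then have i: "?u \<otimes> inv ?u = \<one>" "inv ?u \<in> carrier E" "?u \<in> carrier E"
      using inv_nz[of ?u] c by auto
    have "z = (z \<oplus> a \<otimes> r) \<ominus> s \<otimes> b \<otimes> r"
      unfolding b(5) using c by algebra
    also have "\<dots> = s \<otimes> ?u"
      unfolding s_def[symmetric] using c by algebra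
    finally have "s = z \<otimes> inv ?u"
      using i c by (simp add: m_assoc)
    then show False using sQ QI(4)[OF z u(2)] by simp
  qed
  then have disj: "?I \<inter> ?T = {}" by blast
  have one: "\<one>\<^bsub>S\<^esub> \<in> ?T"
    using P'(2) subringE(3)[OF A] subringE(3)[OF subfieldE(1)[OF F]] by simp
  have mult: "a \<otimes>\<^bsub>S\<^esub> b \<in> ?T" if "a \<in> ?T" "b \<in> ?T" for a b
    using that P'(3)[of a b] subringE(6)[OF A] subringE(6)[OF subfieldE(1)[OF F]] by auto
  obtain M where M: "primeideal M S" "?I \<subseteq> M" "M \<inter> ?T = {}"
    using S.exists_primeideal_avoiding[OF ideal_extended_contraction[OF Q'(1) P'(1)] one mult disj] .
  have "z \<in> M" if "z \<in> Q" for z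
  proof -
    have "z \<oplus> \<zero> \<otimes> \<zero> \<in> ?I"
      using that PI(2) subringE(2)[OF A] subringE(2)[OF subfieldE(1)[OF F]] by blast
    then have "z \<oplus> \<zero> \<otimes> \<zero> \<in> M" by (rule subsetD[OF M(2)])
    moreover have "z \<in> carrier E" using that QI(1) A_carrier[of z] by blast
    ultimately show ?thesis by simp
  qed
  moreover have "a \<in> M" if "a \<in> P" "a \<in> F" for a
  proof -
    have "\<zero> \<oplus> a \<otimes> \<one> \<in> ?I"
      using that QI(2) subringE(3)[OF A] by blast
    then have "\<zero> \<oplus> a \<otimes> \<one> \<in> M" by (rule subsetD[OF M(2)])
    then show ?thesis using F_carrier[OF that(2)] by simp
  qed
  moreover have "M \<inter> F \<subseteq> P"
    using M(3) ideal_S(1)[OF primeideal_S(1)[OF M(1)]] by blast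
  ultimately show thesis using that[OF M(1)] by blast
qed

text \<open>Missing all products \<open>s t\<close> bounds the prime twice: \<open>s = 1\<close>
  keeps it inside \<open>Q\<close>, and \<open>t = 1\<close> keeps its contraction inside
  \<open>P\<close>. If \<open>a r = s t\<close> with \<open>a\<close> in
  \<open>P \<inter> F\<close>, then \<open>a = s b\<close>, and cancelling \<open>s\<close> in the
  field gives \<open>t = b r\<close>, which is in \<open>Q\<close> since \<open>b\<close> lies in
  \<open>P \<inter> F\<close>. Behind this is the flatness of torsion-free modules over a valuation
  ring.\<close>

lemma going_down:
  assumes Q: "primeideal Q S" and P: "primeideal P S" and PQ: "P \<inter> F \<subseteq> Q \<inter> F"
  obtains Q' where "primeideal Q' S" "Q' \<subseteq> Q" "Q' \<inter> F = P \<inter> F"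
proof -
  interpret S: cring S by (rule cring_S)
  note P' = primeideal_S[OF P] and Q' = primeideal_S[OF Q]
  note PI = ideal_S[OF P'(1)] and QI = ideal_S[OF Q'(1)]
  let ?I = "{z \<oplus> a \<otimes> r | z a r. z \<in> {\<zero>} \<and> a \<in> P \<inter> F \<and> r \<in> A}"
  let ?T = "{s \<otimes> t | s t. s \<in> A \<inter> F - P \<and> t \<in> A - Q}"
  have "a \<otimes> r \<noteq> s \<otimes> t" if a: "a \<in> P" "a \<in> F" and r: "r \<in> A"
    and s: "s \<in> A" "s \<in> F" "s \<notin> P" and t: "t \<in> A" "t \<notin> Q" for a r s t
  proof
    assume eq: "a \<otimes> r = s \<otimes> t"
    show False
    proof (cases "a = \<zero>")
      case True
      then have "s \<otimes> t = \<zero>" using eq r A_carrier by simp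
      then show False
        using integral[OF _ A_carrier[OF s(1)] A_carrier[OF t(1)]] s t PI(2) QI(2) by blast
    next
      case False
      then obtain b where b: "b \<in> P" "b \<in> F" "a = s \<otimes> b" "s \<noteq> \<zero>"
        using divide_contraction[OF P a _ s] by blast
      note c = A_carrier[OF s(1)] A_carrier[OF r] A_carrier[OF t(1)] F_carrier[OF b(2)]
      have "s \<otimes> (b \<otimes> r) = s \<otimes> t" using eq c unfolding b(3) by (simp add: m_assoc)
      then have "b \<otimes> r = t" using c b(4) m_lcancel[of s] by simp
      then show False using QI(4)[of b r] b PQ r t by blast
    qed
  qed
  then have disj: "?I \<inter> ?T = {}"
    using A_carrier F_carrier by auto
  have one: "\<one> \<in> A \<inter> F - P" "\<one> \<in> A - Q"
    using P'(2) Q'(2) subringE(3)[OF A] subringE(3)[OF subfieldE(1)[OF F]] by auto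
  then have one': "\<one>\<^bsub>S\<^esub> \<in> ?T" by force
  have mult: "x \<otimes>\<^bsub>S\<^esub> y \<in> ?T" if xy: "x \<in> ?T" "y \<in> ?T" for x y
  proof -
    obtain s t where x: "x = s \<otimes> t" "s \<in> A \<inter> F - P" "t \<in> A - Q"
      using xy(1) by auto
    obtain s' t' where y: "y = s' \<otimes> t'" "s' \<in> A \<inter> F - P" "t' \<in> A - Q"
      using xy(2) by auto
    have "s \<in> carrier E" "t \<in> carrier E" "s' \<in> carrier E" "t' \<in> carrier E"
      using x y A_carrier by auto
    then have "x \<otimes> y = (s \<otimes> s') \<otimes> (t \<otimes> t')"
      unfolding x(1) y(1) by algebra
    moreover have "s \<otimes> s' \<in> A \<inter> F - P" "t \<otimes> t' \<in> A - Q"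
      using x y P'(3)[of s s'] Q'(3)[of t t'] subringE(6)[OF A]
        subringE(6)[OF subfieldE(1)[OF F]] by auto
    ultimately show ?thesis by auto
  qed
  have "ideal {\<zero>} S" using S.zeroideal by simp
  note ideal = ideal_extended_contraction[OF this P'(1)]
  obtain M where M: "primeideal M S" "?I \<subseteq> M" "M \<inter> ?T = {}"
    using S.exists_primeideal_avoiding[OF ideal one' mult disj] .
  have MA: "M \<subseteq> A" using ideal_S(1)[OF primeideal_S(1)[OF M(1)]] .
  have "M \<subseteq> Q"
  proof
    fix x assume x: "x \<in> M"
    have xA: "x \<in> A" using x MA by blast
    have "\<one> \<otimes> x \<in> ?T" if "x \<notin> Q" using that one xA by blast
    then have "x \<in> ?T" if "x \<notin> Q" using that A_carrier[OF xA] by simp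
    then show "x \<in> Q" using x M(3) by blast
  qed
  moreover have "a \<in> M" if "a \<in> P" "a \<in> F" for a
  proof -
    have "\<zero> \<oplus> a \<otimes> \<one> \<in> ?I"
      using that subringE(3)[OF A] by blast
    then have "\<zero> \<oplus> a \<otimes> \<one> \<in> M" by (rule subsetD[OF M(2)])
    then show ?thesis using F_carrier[OF that(2)] by simp
  qed
  moreover have "x \<in> P" if "x \<in> M" "x \<in> F" for x
  proof -
    have "x \<otimes> \<one> \<in> ?T" if "x \<notin> P" using that one \<open>x \<in> M\<close> \<open>x \<in> F\<close> MA by blast
    then have "x \<in> ?T" if "x \<notin> P" using that F_carrier[OF \<open>x \<in> F\<close>] by simp
    then show "x \<in> P" using that(1) M(3) by blast
  qed
  ultimately show thesis using that[OF M(1)] by blast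
qed

section \<open>Lifting chains of primes, and the height formula\<close>

lemma going_up_chain:
  assumes Q: "primeideal Q S" and P: "prime_chain S n P" and QP: "Q \<inter> F \<subseteq> P 0 \<inter> F"
  obtains P' where "prime_chain S n P'" "Q \<subseteq> P' 0" "P' 0 \<inter> F = P 0 \<inter> F"
proof -
  have "\<exists>P'. prime_chain S n P' \<and> Q \<subseteq> P' 0 \<and> (\<forall>i\<le>n. P' i \<inter> F = P i \<inter> F)"
    using P
  proof (induction n)
    case 0
    then have "primeideal (P 0) S" by (simp add: prime_chain_def)
    then obtain Q' where "primeideal Q' S" "Q \<subseteq> Q'" "Q' \<inter> F = P 0 \<inter> F"
      using going_up[OF Q _ QP] by blast
    then show ?case by (intro exI[of _ "\<lambda>_. Q'"]) (simp add: prime_chain_def)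
  next
    case (Suc n)
    then have "prime_chain S n P" by (simp add: prime_chain_def)
    then obtain P' where P': "prime_chain S n P'" "Q \<subseteq> P' 0" "\<forall>i\<le>n. P' i \<inter> F = P i \<inter> F"
      using Suc.IH by blast
    have pr: "primeideal (P n) S" "primeideal (P (Suc n)) S" "P n \<subset> P (Suc n)" "primeideal (P' n) S"
      using Suc.prems P'(1) by (simp_all add: prime_chain_def)
    \<comment> \<open>Going up controls only contractions and gives a weak inclusion of primes.
      Incomparability makes the contractions of the given chain strictly increasing, so the lifted
      chain is strict as well.\<close>
    have lt: "P' n \<inter> F \<subset> P (Suc n) \<inter> F" using incomparability[OF pr(1-3)] P'(3) by simp
    then obtain M where M: "primeideal M S" "P' n \<subseteq> M" "M \<inter> F = P (Suc n) \<inter> F"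
      using going_up[OF pr(4,2)] by blast
    then have "P' n \<subset> M" using lt by blast
    then have "prime_chain S (Suc n) (P'(Suc n := M))"
      using P'(1) M(1) by (auto simp: prime_chain_def le_Suc_eq less_Suc_eq)
    then show ?case
      using P'(2,3) M(3) by (intro exI[of _ "P'(Suc n := M)"]) (simp add: le_Suc_eq del: fun_upd_apply, simp)
  qed
  then show thesis using that by blast
qed

text \<open>The lift is anchored at its top below \<open>Q\<close> and grows downwards. The
  induction therefore lifts the chain without its smallest member and then puts one more prime in
  front with \<open>case_nat\<close>.\<close>

lemma going_down_chain:
  assumes Q: "primeideal Q S" and P: "prime_chain S n P" and PQ: "P n \<inter> F \<subseteq> Q \<inter> F"
  obtains P' where "prime_chain S n P'" "P' n \<subseteq> Q" "P' n \<inter> F = P n \<inter> F"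
proof -
  have "\<exists>P'. prime_chain S n P' \<and> P' n \<subseteq> Q \<and> (\<forall>i\<le>n. P' i \<inter> F = P i \<inter> F)"
    using P PQ
  proof (induction n arbitrary: P)
    case 0
    then have "primeideal (P 0) S" by (simp add: prime_chain_def)
    then obtain Q' where "primeideal Q' S" "Q' \<subseteq> Q" "Q' \<inter> F = P 0 \<inter> F"
      using going_down[OF Q _ 0(2)] by blast
    then show ?case by (intro exI[of _ "\<lambda>_. Q'"]) (simp add: prime_chain_def)
  next
    case (Suc n)
    then have chain: "primeideal (P 0) S" "P 0 \<subset> P 1" "prime_chain S n (\<lambda>i. P (Suc i))"
      by (simp_all add: prime_chain_Suc_shift)
    then obtain P' where P': "prime_chain S n P'" "P' n \<subseteq> Q" "\<forall>i\<le>n. P' i \<inter> F = P (Suc i) \<inter> F"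
      using Suc.IH[of "\<lambda>i. P (Suc i)"] Suc.prems by auto
    have pr: "primeideal (P 1) S" "primeideal (P' 0) S"
      using chain(3) P'(1) by (simp_all add: prime_chain_def)
    have lt: "P 0 \<inter> F \<subset> P' 0 \<inter> F"
      using incomparability[OF chain(1) pr(1) chain(2)] P'(3) by simp
    then obtain M where M: "primeideal M S" "M \<subseteq> P' 0" "M \<inter> F = P 0 \<inter> F"
      using going_down[OF pr(2) chain(1)] by blast
    then have "M \<subset> P' 0" using lt by blast
    then have "prime_chain S (Suc n) (case_nat M P')"
      using P'(1) M(1) by (simp add: prime_chain_Suc_shift)
    moreover have "case_nat M P' i \<inter> F = P i \<inter> F" if "i \<le> Suc n" for i
      using that M(3) P'(3) by (cases i) simp_all
    ultimately show ?case using P'(2) by (intro exI[of _ "case_nat M P'"]) simp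
  qed
  then show thesis using that by blast
qed

lemma height_formula:
  assumes Q: "primeideal Q S"
  shows "krull_dim S = height S Q + krull_dim (S Quot Q)"
proof (rule antisym)
  interpret S: cring S by (rule cring_S)
  show "height S Q + krull_dim (S Quot Q) \<le> krull_dim S"
    by (rule S.height_add_krull_dim_quotient_le[OF Q])
  have "enat n \<le> height S Q + krull_dim (S Quot Q)" if P: "prime_chain S n P" for n P
  proof -
    have pr: "primeideal (P i) S" if "i \<le> n" for i
      using P that by (simp add: prime_chain_def)
    \<comment> \<open>\<open>j\<close> is the first index at which the contraction contains that of
      \<open>Q\<close>, and \<open>Suc n\<close> if there is none. The \<open>j\<close> primes
      before it are lifted below \<open>Q\<close>, and \<open>Q\<close> is appended: length
      \<open>j\<close>. The prime \<open>P j\<close> may have the same contraction as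
      \<open>Q\<close>, so \<open>Q\<close> takes its place and only the later primes are lifted
      above it: length \<open>n - j\<close>, which is truncated to 0 when
      \<open>j = Suc n\<close>.\<close>
    define j where "j = (LEAST i. i = Suc n \<or> Q \<inter> F \<subseteq> P i \<inter> F)"
    have j: "j = Suc n \<or> Q \<inter> F \<subseteq> P j \<inter> F" and j_le: "j \<le> Suc n"
      unfolding j_def by (rule LeastI, blast) (rule Least_le, blast)
    have less: "P i \<inter> F \<subset> Q \<inter> F" if "i < j" for i
    proof -
      have "\<not> Q \<inter> F \<subseteq> P i \<inter> F" "i \<le> n"
        using not_less_Least[of i] that j_le unfolding j_def by auto
      then show ?thesis
        using contractions_comparable primeideal_S(1) pr Q by blast
    qed
    have "enat j \<le> height S Q"
    proof (cases j)
      case 0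
      then show ?thesis by (simp add: zero_enat_def[symmetric])
    next
      case (Suc i)
      have "prime_chain S i P" using P Suc j_le by (simp add: prime_chain_def)
      moreover have lt: "P i \<inter> F \<subset> Q \<inter> F" using less Suc by simp
      ultimately obtain C where C: "prime_chain S i C" "C i \<subseteq> Q" "C i \<inter> F = P i \<inter> F"
        using going_down_chain[OF Q] by blast
      then have "C i \<subset> Q" using lt by blast
      then have "prime_chain S j (C(j := Q))"
        using C(1) Q Suc by (auto simp: prime_chain_def le_Suc_eq less_Suc_eq)
      then show ?thesis by (rule prime_chain_le_height) simp
    qed
    moreover have "enat (n - j) \<le> krull_dim (S Quot Q)"
    proof (cases "n - j")
      case 0
      then show ?thesis by (simp add: zero_enat_def[symmetric])
    next
      case (Suc k)
      then have nk: "n = j + Suc k" by simp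
      have "P j \<inter> F \<subset> P (Suc j) \<inter> F"
        using incomparability pr P nk by (simp add: prime_chain_def)
      then have lt: "Q \<inter> F \<subset> P (Suc j) \<inter> F" using j nk by auto
      have "prime_chain S k (\<lambda>i. P (Suc j + i))"
        using P nk by (simp add: prime_chain_def)
      then obtain C where C: "prime_chain S k C" "Q \<subseteq> C 0" "C 0 \<inter> F = P (Suc j) \<inter> F"
        using going_up_chain[OF Q, of k "\<lambda>i. P (Suc j + i)"] lt by auto
      then have "Q \<subset> C 0" using lt by blast
      then have "prime_chain S (Suc k) (case_nat Q C)"
        using C(1) Q by (simp add: prime_chain_Suc_shift)
      then have "\<exists>C. prime_chain (S Quot Q) (Suc k) C"
        using S.prime_chain_quotient_iff[OF Q] by (metis nat.case(1) order_refl)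
      then show ?thesis using Suc prime_chain_le_krull_dim by metis
    qed
    ultimately have "enat j + enat (n - j) \<le> height S Q + krull_dim (S Quot Q)"
      by (rule add_mono)
    moreover have "enat n \<le> enat j + enat (n - j)" by simp
    ultimately show ?thesis by (rule order_trans[rotated])
  qed
  then show "krull_dim S \<le> height S Q + krull_dim (S Quot Q)"
    unfolding krull_dim_def[of S] by (intro Sup_least) blast
qed

end

section \<open>Torsion quasi-valuations\<close>

locale torsion_quasi_valuation = field E
  for E :: "('a, 'r) ring_scheme" (structure) +
  fixes F :: "'a set"
    and v :: "'a \<Rightarrow> 'g::linordered_ab_group_add top"
    and w :: "'a \<Rightarrow> 'm::{linorder, ordered_comm_monoid_add} top"
    and \<iota> :: "'g \<Rightarrow> 'm"
  assumes F: "subfield F E"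
    and finite: "finite_dimension F (carrier E)"
    and v: "valuation (E\<lparr>carrier := F\<rparr>) v"
    and w: "quasi_valuation E w"
    and ext: "extends_valuation (E\<lparr>carrier := F\<rparr>) v \<iota> w"
    and torsion: "torsion_over (w ` (carrier E - {\<zero>})) (\<iota> ` value_group (E\<lparr>carrier := F\<rparr>) v)"
begin

abbreviation "\<Gamma> \<equiv> value_group (E\<lparr>carrier := F\<rparr>) v"

abbreviation "O\<^sub>w \<equiv> {x \<in> carrier E. 0 \<le> w x}"

lemma F_carrier: "x \<in> F \<Longrightarrow> x \<in> carrier E"
  using subfieldE(3)[OF F] by blast

lemma v_mult: "x \<in> F \<Longrightarrow> y \<in> F \<Longrightarrow> v (x \<otimes> y) = v x + v y"
  using v by (simp add: valuation_def)

lemma w_mult: "x \<in> carrier E \<Longrightarrow> y \<in> carrier E \<Longrightarrow> w x + w y \<le> w (x \<otimes> y)"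
  using w by (simp add: quasi_valuation_def)

lemma w_add: "x \<in> carrier E \<Longrightarrow> y \<in> carrier E \<Longrightarrow> min (w x) (w y) \<le> w (x \<oplus> y)"
  using w by (simp add: quasi_valuation_def)

lemma value_cases:
  assumes "x \<in> F" "x \<noteq> \<zero>"
  obtains g where "g \<in> \<Gamma>" "v x = top.Value g" "w x = top.Value (\<iota> g)"
proof -
  have "v x \<noteq> top.Top"
    using v assms by (simp add: valuation_def)
  then obtain g where g: "v x = top.Value g" by (cases "v x") auto
  then have "g \<in> \<Gamma>"
    using assms unfolding value_group_def by auto
  moreover have "w x = top.Value (\<iota> g)"
    using ext assms g by (simp add: extends_valuation_def)
  ultimately show thesis using that g by blast
qed

lemma \<iota>_hom:
  shows "\<iota> 0 = 0"
    and "g \<in> \<Gamma> \<Longrightarrow> h \<in> \<Gamma> \<Longrightarrow> \<iota> (g + h) = \<iota> g + \<iota> h"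
    and "g \<in> \<Gamma> \<Longrightarrow> h \<in> \<Gamma> \<Longrightarrow> \<iota> g \<le> \<iota> h \<longleftrightarrow> g \<le> h"
  using ext by (auto simp: extends_valuation_def ordered_submonoid_embedding_def)

lemma add_mem_value_group:
  assumes "g \<in> \<Gamma>" "h \<in> \<Gamma>"
  shows "g + h \<in> \<Gamma>"
proof -
  obtain x y where xy: "x \<in> F" "y \<in> F" "x \<noteq> \<zero>" "y \<noteq> \<zero>" "v x = top.Value g" "v y = top.Value h"
    using assms unfolding value_group_def by auto
  then have "x \<otimes> y \<in> F" "x \<otimes> y \<noteq> \<zero>"
    using subringE(6)[OF subfieldE(1)[OF F]] integral F_carrier by blast+
  moreover have "v (x \<otimes> y) = top.Value (g + h)"
    using v_mult xy by simp
  ultimately show ?thesis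
    unfolding value_group_def by auto
qed

lemma v_one: "v \<one> = top.Value 0"
proof -
  have one: "\<one> \<in> F" using subringE(3)[OF subfieldE(1)[OF F]] .
  then obtain g where "v \<one> = top.Value g" using value_cases[of \<one>] by auto
  then show ?thesis using v_mult[OF one one] by simp
qed

lemma zero_mem_value_group: "0 \<in> \<Gamma>"
  unfolding value_group_def using v_one subringE(3)[OF subfieldE(1)[OF F]] by auto

lemma w_nonneg_iff:
  assumes "g \<in> \<Gamma>"
  shows "0 \<le> top.Value (\<iota> g) \<longleftrightarrow> 0 \<le> g"
  using \<iota>_hom(3)[OF zero_mem_value_group assms] \<iota>_hom(1) by (simp add: zero_top_def)

lemma w_one: "w \<one> = 0"
  using ext v_one \<iota>_hom(1) subringE(3)[OF subfieldE(1)[OF F]]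
  by (simp add: extends_valuation_def zero_top_def)

text \<open>Superadditivity of \<open>w\<close> alone would only bound this value above by 0. As
  \<open>v\<close> is multiplicative, its value \<open>g\<close> at -1 satisfies
  \<open>g + g = 0\<close>, and an ordered group has no 2-torsion.\<close>

lemma w_minus_one: "w (\<ominus> \<one>) = 0"
proof -
  have F1: "\<ominus> \<one> \<in> F" using subringE(3,5)[OF subfieldE(1)[OF F]] by blast
  have "\<ominus> \<one> \<otimes> \<ominus> \<one> = \<one>" by algebra
  moreover from this have "\<ominus> \<one> \<noteq> \<zero>" by auto
  then obtain g where g: "v (\<ominus> \<one>) = top.Value g" "w (\<ominus> \<one>) = top.Value (\<iota> g)"
    using value_cases[OF F1] by blast
  ultimately have "g + g = 0" using v_mult[OF F1 F1] v_one by simp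
  then show ?thesis using g \<iota>_hom(1) by (simp add: zero_top_def)
qed

lemma w_minus:
  assumes "x \<in> carrier E"
  shows "w x \<le> w (\<ominus> x)"
proof -
  have "\<ominus> \<one> \<otimes> x = \<ominus> x" using assms by (simp add: l_minus)
  then show ?thesis using w_mult[of "\<ominus> \<one>" x] assms w_minus_one by simp
qed

lemma subring_Ow: "subring O\<^sub>w E"
proof (rule subringI)
  fix x y assume "x \<in> O\<^sub>w" "y \<in> O\<^sub>w"
  then have x: "x \<in> carrier E" "0 \<le> w x" and y: "y \<in> carrier E" "0 \<le> w y" by auto
  have "0 \<le> w x + w y" using x(2) y(2) by (rule add_nonneg_nonneg)
  then show "x \<otimes> y \<in> O\<^sub>w" using w_mult[OF x(1) y(1)] x(1) y(1) by auto
  have "0 \<le> min (w x) (w y)" using x(2) y(2) by simp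
  then show "x \<oplus> y \<in> O\<^sub>w" using order_trans[OF _ w_add[OF x(1) y(1)]] x(1) y(1) by simp
next
  fix x assume "x \<in> O\<^sub>w"
  then have "x \<in> carrier E" "0 \<le> w x" by simp_all
  then show "\<ominus> x \<in> O\<^sub>w" using order_trans[OF _ w_minus] by simp
qed (use w_one in auto)

lemma v_inv:
  assumes "x \<in> F" "x \<noteq> \<zero>" "v x = top.Value g"
  shows "inv x \<in> F" "inv x \<noteq> \<zero>" "v (inv x) = top.Value (- g)"
proof -
  show inv: "inv x \<in> F" "inv x \<noteq> \<zero>" using subfield_m_inv(1)[OF F, of x] assms by auto
  obtain h where h: "v (inv x) = top.Value h" using value_cases[OF inv] by blast
  have "x \<otimes> inv x = \<one>" using subfield_m_inv(2)[OF F, of x] assms by auto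
  then have "g + h = 0" using v_mult[OF assms(1) inv(1)] v_one assms(3) h by simp
  then show "v (inv x) = top.Value (- g)" using h by (simp add: eq_neg_iff_add_eq_0 add.commute)
qed

lemma mem_Ow_iff:
  assumes "x \<in> F" "v x = top.Value g"
  shows "x \<in> O\<^sub>w \<longleftrightarrow> 0 \<le> g"
proof -
  have "x \<noteq> \<zero>" using v assms by (auto simp: valuation_def)
  then show ?thesis
    using value_cases[OF assms(1)] assms w_nonneg_iff F_carrier by (metis (mono_tags, lifting) mem_Collect_eq top.inject)
qed

text \<open>Positive elements of \<open>\<Gamma>\<close> are not absorbed by torsion values, although \<open>'m\<close> need not be
  cancellative.\<close>

lemma torsion_not_absorbing:
  assumes "g \<in> \<Gamma>" "0 < g" and x: "x \<in> carrier E" "x \<noteq> \<zero>"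
  shows "w x < top.Value (\<iota> g) + w x"
proof (rule ccontr)
  have "\<exists>k\<ge>1. (\<Sum>_<k::nat. w x) \<in> top.Value ` \<iota> ` \<Gamma>"
    using torsion x unfolding torsion_over_def by blast
  then obtain k :: nat and h
    where k: "k \<ge> 1" and h: "h \<in> \<Gamma>" "(\<Sum>_<k. w x) = top.Value (\<iota> h)"
    by blast
  have "0 \<le> top.Value (\<iota> g)" using assms w_nonneg_iff by simp
  then have "w x \<le> top.Value (\<iota> g) + w x"
    using add_right_mono[of 0 "top.Value (\<iota> g)" "w x"] by simp
  moreover assume "\<not> w x < top.Value (\<iota> g) + w x"
  ultimately have absorb: "top.Value (\<iota> g) + w x = w x" by simp
  \<comment> \<open>One summand \<open>w x\<close> is split off the multiple in the value group. If
    it absorbs \<iota> \<open>g\<close>, so does the whole sum, and the equation moves into the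
    group, where cancellation is available.\<close>
  obtain j where "k = Suc j" using k by (cases k) auto
  then have "(\<Sum>_<k. w x) = w x + (\<Sum>_<j. w x)" by (simp add: add.commute)
  then have "top.Value (\<iota> g) + top.Value (\<iota> h) = top.Value (\<iota> h)"
    using h(2) absorb by (metis add.assoc)
  then have "\<iota> (g + h) = \<iota> h" using \<iota>_hom(2)[OF assms(1) h(1)] by simp
  then have "g + h \<le> h"
    using \<iota>_hom(3)[OF add_mem_value_group[OF assms(1) h(1)] h(1)] by simp
  then show False using assms(2) by simp
qed

text \<open>For \<open>w y > 0\<close>, comparing values in \<open>z = 1 + y z\<close> with \<open>z = (1 - y)\<inverse>\<close> forces
  \<open>w z \<ge> 0\<close>, since \<open>w (y z) > w z\<close>.\<close>

lemma one_minus_inverse_Ow: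
  assumes g: "g \<in> \<Gamma>" "0 < g" and y: "y \<in> carrier E" "top.Value (\<iota> g) \<le> w y"
  shows "y \<noteq> \<one> \<and> inv (\<one> \<ominus> y) \<in> O\<^sub>w"
proof
  show "y \<noteq> \<one>"
  proof
    assume "y = \<one>"
    then have "\<iota> g \<le> \<iota> 0" using y(2) w_one \<iota>_hom(1) by (simp add: zero_top_def)
    then show False using \<iota>_hom(3)[OF g(1) zero_mem_value_group] g(2) by simp
  qed
  then have nz: "\<one> \<ominus> y \<noteq> \<zero>" using y(1) r_right_minus_eq[of \<one> y] by auto
  define z where "z = inv (\<one> \<ominus> y)"
  have "\<one> \<ominus> y \<in> Units E" using nz y(1) by (simp add: field_Units)
  then have z: "z \<in> carrier E" "(\<one> \<ominus> y) \<otimes> z = \<one>"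
    unfolding z_def by simp_all
  then have "z \<noteq> \<zero>" using y(1) by auto
  have "z = (\<one> \<ominus> y) \<otimes> z \<oplus> y \<otimes> z" using z(1) y(1) by algebra
  then have "min 0 (w (y \<otimes> z)) \<le> w z"
    using w_add[of \<one> "y \<otimes> z"] z y(1) w_one by simp
  moreover have "w z < w (y \<otimes> z)"
    using torsion_not_absorbing[OF g z(1) \<open>z \<noteq> \<zero>\<close>] add_right_mono[OF y(2), of "w z"]
      w_mult[OF y(1) z(1)] by simp
  ultimately have "0 \<le> w z" by (auto simp: min_le_iff_disj)
  then show "inv (\<one> \<ominus> y) \<in> O\<^sub>w" using z(1) unfolding z_def by simp
qed

text \<open>The contraction of \<open>O_w\<close> to \<open>F\<close> is the valuation ring of
  \<open>v\<close>, so a nonzero nonunit \<open>a\<close> in it has a value \<open>g > 0\<close>.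
  For \<open>r\<close> in \<open>O_w\<close> superadditivity gives \<open>a r\<close> at least the
  value of \<open>a\<close>, and \<open>one_minus_inverse_Ow\<close> applies. Finiteness of
  \<open>E\<close> over \<open>F\<close> enters as algebraicity.\<close>

sublocale algebraic_valuation_ext E F "O\<^sub>w"
proof (intro algebraic_valuation_ext.intro algebraic_valuation_ext_axioms.intro)
  show "field E" by (rule field_axioms)
  show "subfield F E" by (rule F)
  show "subring O\<^sub>w E" by (rule subring_Ow)
  show "(algebraic over F) x" if "x \<in> carrier E" for x
    using finite_dimension_imp_algebraic[OF F carrier_is_subring finite that] .
  show "inv x \<in> O\<^sub>w" if x: "x \<in> F" "x \<notin> O\<^sub>w" for x
  proof -
    have nz: "x \<noteq> \<zero>" using x(2) subringE(2)[OF subring_Ow] by blast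
    obtain g where g: "v x = top.Value g" using value_cases[OF x(1) nz] by blast
    have "g < 0" using mem_Ow_iff[OF x(1) g] x(2) by simp
    then show ?thesis
      using mem_Ow_iff[OF v_inv(1,3)[OF x(1) nz g]] by simp
  qed
  show "a \<otimes> r \<noteq> \<one> \<and> inv (\<one> \<ominus> a \<otimes> r) \<in> O\<^sub>w"
    if a: "a \<in> F" "a \<in> O\<^sub>w" "a \<noteq> \<zero>" "inv a \<notin> O\<^sub>w" and r: "r \<in> O\<^sub>w" for a r
  proof -
    obtain g where g: "g \<in> \<Gamma>" "v a = top.Value g" "w a = top.Value (\<iota> g)"
      using value_cases[OF a(1,3)] by blast
    have "0 < g"
      using mem_Ow_iff[OF v_inv(1,3)[OF a(1,3) g(2)]] a(4) by simp
    moreover have "top.Value (\<iota> g) \<le> w (a \<otimes> r)"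
      using add_left_mono[of 0 "w r" "w a"] w_mult[of a r] a(2) r g(3) by simp
    ultimately show ?thesis
      using one_minus_inverse_Ow[OF g(1)] a(2) r by simp
  qed
qed

end

theorem theorem6p4:
  fixes E :: "('a, 'r) ring_scheme"
    and F :: "'a set"
    and v :: "'a \<Rightarrow> 'g::linordered_ab_group_add top"
    and w :: "'a \<Rightarrow> 'm::{linorder, ordered_comm_monoid_add} top"
    and \<iota> :: "'g \<Rightarrow> 'm"
  assumes "field E"
    and "subfield F E"
    and "ring.finite_dimension E F (carrier E)"
    and "valuation (E\<lparr>carrier := F\<rparr>) v"
    and "quasi_valuation E w"
    and "extends_valuation (E\<lparr>carrier := F\<rparr>) v \<iota> w"
    and "torsion_over (w ` (carrier E - {\<zero>\<^bsub>E\<^esub>})) (\<iota> ` value_group (E\<lparr>carrier := F\<rparr>) v)"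
  shows "\<forall>Q. primeideal Q (quasi_valuation_ring E w) \<longrightarrow>
    krull_dim (quasi_valuation_ring E w) =
      height (quasi_valuation_ring E w) Q + krull_dim (quasi_valuation_ring E w Quot Q)"
proof -
  interpret field E by fact
  interpret torsion_quasi_valuation E F v w \<iota>
    by (intro torsion_quasi_valuation.intro torsion_quasi_valuation_axioms.intro assms)
  show ?thesis
    unfolding quasi_valuation_ring_def using height_formula by blast
qed

end
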